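(* Let $b \ge 2$ be an integer and let $\xi$ be an irrational real number. If $\mu$ denotes the irrationality exponent of $\xi$, then $$\liminf_{n \to +\infty} \frac{p(n,\xi,b)}{n} \ge 1 + \frac{1 - 2\mu(\mu-1)(\mu-2)}{\mu^3(\mu-1)}$$ and $$\limsup_{n \to +\infty} \frac{p(n,\xi,b)}{n} \ge 1 + \frac{1 - 2\mu(\mu-1)(\mu-2)}{3\mu^3 - 6\mu^2 + 4\mu - 1}.$$ In particular, every irrational real number $\xi$ whose irrationality exponent is equal to $2$ satisfies $$\liminf_{n \to +\infty} \frac{p(n,\xi,b)}{n} \ge \frac{9}{8} \quad\text{and}\quad \limsup_{n \to +\infty} \frac{p(n,\xi,b)}{n} \ge \frac{8}{7}.$$
   Context: The $b$-ary expansion of a real number $\xi$ is the unique infinite sequence $(a_j)_{j\ge 1}$ of integers from $\{0,1,\ldots,b-1\}$ such that $\xi = \lfloor \xi \rfloor + \sum_{j\ge 1} a_j/b^j$ and $a_j \ne b-1$ for infinitely many indices $j$. For $n \ge 1$, $p(n,\xi,b)$ is the number of distinct blocks of length $n$ in this expansion: $p(n,\xi,b) = \#\{a_{j+1}a_{j+2}\cdots a_{j+n} : j \ge 0\}$. The irrationality exponent $\mu(\xi)$ of an irrational real number $\xi$ is the supremum of the real numbers $\mu$ such that $|\xi - p/q| < 1/q^{\mu}$ has infinitely many solutions in rational numbers $p/q$ (with $q\ge 1$); it always satisfies $\mu(\xi)\ge 2$ and may be $+\infty$. When $\mu = +\infty$, the right-hand sides of the first two displayed inequalities are understood as their limits as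 $\mu \to +\infty$, namely $1$ and $1/3$. *)

theory Defs
  imports "HOL-Analysis.Analysis"
begin

text \<open>Digits are indexed from 0: the value \<open>a j\<close> is the usual $a_{j+1}$, the coefficient of
  $b^{-(j+1)}$.\<close>

definition is_expansion :: "nat \<Rightarrow> real \<Rightarrow> (nat \<Rightarrow> nat) \<Rightarrow> bool" where
  "is_expansion b \<xi> a \<longleftrightarrow>
     (\<forall>j. a j < b) \<and>
     (\<lambda>j. real (a j) / real b ^ (j + 1)) sums (\<xi> - of_int \<lfloor>\<xi>\<rfloor>) \<and>
     infinite {j. a j \<noteq> b - 1}"

definition expansion :: "nat \<Rightarrow> real \<Rightarrow> nat \<Rightarrow> nat" where
  "expansion b \<xi> = (THE a. is_expansion b \<xi> a)"

definition complexity :: "nat \<Rightarrow> real \<Rightarrow> nat \<Rightarrow> nat" where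
  "complexity n \<xi> b = card {map (\<lambda>i. expansion b \<xi> (j + i)) [0..<n] | j. True}"

text \<open>Solutions are counted as rational numbers, not as pairs of a numerator and a denominator.\<close>

definition irrationality_exponent :: "real \<Rightarrow> ereal" where
  "irrationality_exponent \<xi> =
     Sup {ereal \<mu> | \<mu>.
       infinite {r. \<exists>p q :: int. q \<ge> 1 \<and> r = of_int p / of_int q \<and>
                      \<bar>\<xi> - r\<bar> < 1 / of_int q powr \<mu>}}"

lemma sums_digits_max:
  assumes "b \<ge> 2"
  shows "(\<lambda>j. (real b - 1) / real b ^ (j + 1)) sums 1"
proof -
  have "(\<lambda>j. (1 / real b) ^ j) sums (1 / (1 - 1 / real b))"
    using assms by (intro geometric_sums) auto
  from sums_mult[OF this, of "(real b - 1) / real b"] show ?thesis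
    using assms by (simp add: field_simps)
qed

lemma digit_sum_less_1:
  assumes b: "b \<ge> 2" and lt: "\<And>j. a j < b" and ne: "a k \<noteq> b - 1"
    and s: "(\<lambda>j. real (a j) / real b ^ (j + 1)) sums t"
  shows "0 \<le> t" "t < 1"
proof -
  show "0 \<le> t"
    by (rule sums_le[OF _ sums_zero s]) auto
  let ?d = "\<lambda>j. (real b - 1) / real b ^ (j + 1) - real (a j) / real b ^ (j + 1)"
  have le: "real (a j) \<le> real b - 1" for j
    using lt[of j] by linarith
  have d: "?d sums (1 - t)"
    by (rule sums_diff[OF sums_digits_max[OF b] s])
  have "real (a k) < real b - 1"
    using lt[of k] ne b by linarith
  hence "0 < ?d k"
    using b by (simp add: divide_strict_right_mono)
  moreover have "0 \<le> ?d j" for j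
    using divide_right_mono[OF le[of j], of "real b ^ (j + 1)"] by simp
  ultimately have "0 < suminf ?d"
    using sums_summable[OF d] suminf_pos2 by blast
  thus "t < 1"
    using sums_unique[OF d] by simp
qed

lemma is_expansion_unique_aux:
  assumes b: "b \<ge> 2" and "\<And>j. a j < b" "\<And>j. a' j < b"
    and "infinite {j. a j \<noteq> b - 1}" "infinite {j. a' j \<noteq> b - 1}"
    and "(\<lambda>j. real (a j) / real b ^ (j + 1)) sums t"
    and "(\<lambda>j. real (a' j) / real b ^ (j + 1)) sums t"
  shows "a n = a' n"
proof -
  have step: "a 0 = nat \<lfloor>real b * t\<rfloor> \<and>
      (\<lambda>j. real (a (Suc j)) / real b ^ (j + 1)) sums (real b * t - real (a 0)) \<and>
      infinite {j. a (Suc j) \<noteq> b - 1}"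
    if lt: "\<And>j. a j < b" and inf: "infinite {j. a j \<noteq> b - 1}"
      and s: "(\<lambda>j. real (a j) / real b ^ (j + 1)) sums t" for a :: "nat \<Rightarrow> nat" and t
  proof -
    have "(\<lambda>j. real (a j) / real b ^ j) sums (real b * t)"
      using sums_mult[OF s, of "real b"] b by simp
    hence s': "(\<lambda>j. real (a (Suc j)) / real b ^ (j + 1)) sums (real b * t - real (a 0))"
      using sums_Suc_iff[of "\<lambda>j. real (a j) / real b ^ j" "real b * t - real (a 0)"] by simp
    have sub: "{j. a j \<noteq> b - 1} \<subseteq> insert 0 (Suc ` {j. a (Suc j) \<noteq> b - 1})"
    proof
      fix j assume "j \<in> {j. a j \<noteq> b - 1}"
      thus "j \<in> insert 0 (Suc ` {j. a (Suc j) \<noteq> b - 1})" by (cases j) auto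
    qed
    hence inf': "infinite {j. a (Suc j) \<noteq> b - 1}"
      using inf finite_subset[OF sub] by blast
    then obtain k where "a (Suc k) \<noteq> b - 1"
      using not_finite_existsD by blast
    from digit_sum_less_1[OF b lt this s']
    have "\<lfloor>real b * t\<rfloor> = int (a 0)"
      by linarith
    thus ?thesis using s' inf' by simp
  qed
  show ?thesis
    using assms(2-)
  proof (induction n arbitrary: a a' t)
    case 0
    thus ?case using step[of a t] step[of a' t] by metis
  next
    case (Suc n)
    note tails = step[OF Suc.prems(1,3,5)] step[OF Suc.prems(2,4,6)]
    hence "a 0 = a' 0" by simp
    show ?case
    proof (rule Suc.IH[of "\<lambda>j. a (Suc j)" "\<lambda>j. a' (Suc j)" "real b * t - real (a 0)"])
      show "(\<lambda>j. real (a' (Suc j)) / real b ^ (j + 1)) sums (real b * t - real (a 0))"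
        unfolding \<open>a 0 = a' 0\<close> using tails(2) by blast
    qed (use tails Suc.prems(1,2) in auto)
  qed
qed

lemma is_expansion_ex:
  assumes b: "b \<ge> 2"
  shows "\<exists>a. is_expansion b \<xi> a"
proof -
  define t where "t n = frac (real b ^ n * \<xi>)" for n
  define a where "a n = nat \<lfloor>real b * t n\<rfloor>" for n
  have t: "0 \<le> t n" "t n < 1" for n
    by (auto simp: t_def frac_lt_1)
  have "real b * t n < real b" for n
    using b t(2)[of n] by simp
  hence lt: "a n < b" for n
    using b t(1)[of n] unfolding a_def by (smt (verit) floor_less_iff nat_less_iff of_int_of_nat_eq zero_le_floor mult_nonneg_nonneg of_nat_0_le_iff)
  have step: "t (Suc n) = real b * t n - real (a n)" for n
  proof -
    have "frac (real b * t n) = frac (real b ^ Suc n * \<xi>)"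
    proof -
      have "real b ^ Suc n * \<xi> = real b * t n + of_int (int b * \<lfloor>real b ^ n * \<xi>\<rfloor>)"
        by (simp add: t_def frac_def algebra_simps)
      thus ?thesis by (simp add: frac_def)
    qed
    thus ?thesis
      using t(1)[of n] b by (simp add: t_def a_def frac_def)
  qed
  have part: "(\<Sum>j<n. real (a (N + j)) / real b ^ (j + 1)) = t N - t (N + n) / real b ^ n" for N n
  proof (induction n)
    case (Suc n)
    have "t (N + n) / real b ^ n = (real (a (N + n)) + t (N + Suc n)) / real b ^ Suc n"
      using b by (simp add: step)
    thus ?case
      using Suc.IH by (simp add: add_divide_distrib)
  qed simp
  have "(\<lambda>n. t (N + n) / real b ^ n) \<longlonglongrightarrow> 0" for N
  proof (rule Lim_null_comparison)
    show "\<forall>\<^sub>F n in sequentially. norm (t (N + n) / real b ^ n) \<le> (1 / real b) ^ n"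
      using t b by (intro always_eventually allI)
        (simp add: power_one_over divide_right_mono less_imp_le)
    show "(\<lambda>n. (1 / real b) ^ n) \<longlonglongrightarrow> 0"
      using b by (intro LIMSEQ_power_zero) auto
  qed
  from tendsto_diff[OF tendsto_const this]
  have s: "(\<lambda>j. real (a (N + j)) / real b ^ (j + 1)) sums t N" for N
    unfolding sums_def part by simp
  have "infinite {j. a j \<noteq> b - 1}"
  proof
    assume "finite {j. a j \<noteq> b - 1}"
    then obtain N where "\<And>j. a j \<noteq> b - 1 \<Longrightarrow> j < N"
      using finite_nat_set_iff_bounded by auto
    hence "a (N + j) = b - 1" for j
      by (meson not_add_less1)
    hence "(\<lambda>j. (real b - 1) / real b ^ (j + 1)) sums t N"
      using s[of N] b by (simp add: of_nat_diff)
    hence "t N = 1"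
      using sums_digits_max[OF b] sums_unique2 by blast
    thus False using t(2)[of N] by simp
  qed
  moreover have "t 0 = \<xi> - of_int \<lfloor>\<xi>\<rfloor>"
    by (simp add: t_def frac_def)
  ultimately show ?thesis
    using s[of 0] lt unfolding is_expansion_def by auto
qed

lemma is_expansion_expansion:
  assumes "b \<ge> 2"
  shows "is_expansion b \<xi> (expansion b \<xi>)"
proof -
  have "\<exists>!a. is_expansion b \<xi> a"
  proof (rule ex_ex1I)
    show "\<exists>a. is_expansion b \<xi> a" by (rule is_expansion_ex[OF assms])
  next
    fix a a' assume "is_expansion b \<xi> a" "is_expansion b \<xi> a'"
    thus "a = a'"
      unfolding is_expansion_def using is_expansion_unique_aux[OF assms, of a a'] by (intro ext) blast
  qed
  thus ?thesis unfolding expansion_def by (rule theI')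
qed

end

theory Submission
  imports Defs "HOL-Analysis.Kronecker_Approximation_Theorem"
begin

text \<open>
  A repetition in the expansion of \<open>\<xi>\<close> is a good rational approximation. If the digits of \<open>\<xi>\<close> have
  period \<open>s\<close> from position \<open>m\<close> up to position \<open>E\<close>, then \<open>\<xi>\<close> is within about \<open>b\<close> to the power \<open>-E\<close> of
  a fraction with denominator \<open>b ^ m * (b ^ s - 1)\<close>, so \<open>E \<le> (t + 1) * (m + s) + C\<close> whenever
  \<open>t + 1\<close> exceeds the irrationality exponent (\<open>period_end_le\<close>). On the other hand \<open>p(n)\<close>, the number
  of blocks of length \<open>n\<close>, forces early repetitions: among the first \<open>p(n) + 1\<close> blocks two coincide.
  Both effects are nearly in balance when \<open>\<mu> = 2\<close> and \<open>p(n)\<close> is close to \<open>n\<close>, and the theorem says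
  that the balance cannot be perfect.

  Consider the first repetitions of longer and longer blocks. The \<open>k\<close>-th one has its two occurrences
  at positions \<open>i_k < j_k\<close>, and the occurrences agree for exactly \<open>N_k\<close> digits. The approximation
  bound gives \<open>N_k \<le> t * j_k + C\<close>, and counting blocks gives \<open>j_(k+1) \<le> p(N_k + 1)\<close>; if \<open>p(n) - n\<close> is
  at most about \<open>D\<close>, then \<open>j_(k+1) \<le> N_k + D\<close>. Two further facts break the balance.

  The first is \<open>min_earlier_less\<close>: if a maximal periodic run ends before another run does, then the
  two overlap in fewer letters than the sum of their periods, and this reads
  \<open>N_k + min (i_k) (i_(k+1)) < j_(k+1)\<close>. So of any two consecutive repetitions, one starts at most
  \<open>D\<close> places from the beginning of the word.

  The second is \<open>match_length_le_later_diff\<close>: if the \<open>a\<close>-th and the \<open>b\<close>-th repetition both start near the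
  beginning, then their periods are close to each other, and the difference of the two periods is
  again a period, on a long initial part of the word. Such a short period is excluded by the
  approximation bound, unless \<open>N_a\<close> is small. By the first fact one finds such \<open>a < b \<le> a + 2\<close> among
  any four consecutive repetitions.

  Eliminating all unknowns but \<open>j_(k+2)\<close> from these linear inequalities leaves
  \<open>P * j_(k+2) \<le> R * D + O(1)\<close> with explicit polynomials \<open>P\<close> and \<open>R\<close> in \<open>t\<close> (\<open>J_le_gap_multiple\<close>).
  If \<open>p(n) \<le> (1 + \<delta>) * n\<close> for a single large \<open>n\<close>, the lemma applies with \<open>D\<close> about \<open>\<delta> * n\<close> to the
  repetitions with \<open>N_(k+2) < n \<le> N_(k+3)\<close>, because \<open>p(n) - n\<close> is nondecreasing; this bounds the lower
  limit. If the inequality holds for all large \<open>n\<close>, one may take \<open>n = N_(k+2)\<close> itself and saves one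
  step of the recursion, which gives the larger bound for the upper limit. With \<open>t = \<mu> - 1\<close>, the
  constants of the theorem follow from two polynomial identities; for \<open>\<mu> = 2\<close> there is no loss in this
  step, since \<open>P = 1\<close>, \<open>R = 7\<close>, and \<open>t * R + P = 8\<close>. Whenever the bounds of the theorem do not
  exceed \<open>1\<close>, they follow from \<open>p(n) > n\<close>, which holds for every word that is not ultimately periodic.
\<close>

section \<open>Words that are not ultimately periodic\<close>

definition blocks :: "(nat \<Rightarrow> 'a) \<Rightarrow> nat \<Rightarrow> 'a list set" where
  "blocks x n = {map (\<lambda>i. x (j + i)) [0..<n] | j. True}"

text \<open>The interval of positions is half-open, and no constraint remains when it is shorter than the
  period; this makes the approximation bound below hold for all \<open>E\<close>.\<close>
definition periodic_on :: "(nat \<Rightarrow> 'a) \<Rightarrow> nat \<Rightarrow> nat \<Rightarrow> nat \<Rightarrow> bool" where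
  "periodic_on x s m E \<longleftrightarrow> (\<forall>u\<ge>m. u + s < E \<longrightarrow> x u = x (u + s))"

definition repeats :: "(nat \<Rightarrow> 'a) \<Rightarrow> nat \<Rightarrow> nat \<Rightarrow> nat \<Rightarrow> bool" where
  "repeats x n i j \<longleftrightarrow> i < j \<and> (\<forall>u<n. x (i + u) = x (j + u))"

text \<open>The two occurrences that make up the first repeated block of length \<open>n\<close>, and the length up to
  which they agree.\<close>
definition later :: "(nat \<Rightarrow> 'a) \<Rightarrow> nat \<Rightarrow> nat" where
  "later x n = (LEAST j. \<exists>i. repeats x n i j)"

definition earlier :: "(nat \<Rightarrow> 'a) \<Rightarrow> nat \<Rightarrow> nat" where
  "earlier x n = (SOME i. repeats x n i (later x n))"

definition match_length :: "(nat \<Rightarrow> 'a) \<Rightarrow> nat \<Rightarrow> nat" where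
  "match_length x n = (LEAST l. x (earlier x n + l) \<noteq> x (later x n + l))"

text \<open>The block lengths at which the first repetition changes: up to the length on which the current
  pair of occurrences agrees, that pair remains the first repetition.\<close>
primrec stage :: "(nat \<Rightarrow> 'a) \<Rightarrow> nat \<Rightarrow> nat" where
  "stage x 0 = 0"
| "stage x (Suc k) = Suc (match_length x (stage x k))"

lemma map_shift_eq_iff:
  "map (\<lambda>u. x (i + u)) [0..<n] = map (\<lambda>u. x (j + u)) [0..<n] \<longleftrightarrow> (\<forall>u<n. x (i + u) = x (j + u))"
  by (auto simp: list_eq_iff_nth_eq)

lemma repeats_mono: "repeats x n i j \<Longrightarrow> m \<le> n \<Longrightarrow> repeats x m i j"
  by (auto simp: repeats_def)

lemma periodic_onD: "periodic_on x s m E \<Longrightarrow> m \<le> u \<Longrightarrow> u + s < E \<Longrightarrow> x (u + s) = x u"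
  by (auto simp: periodic_on_def)

locale aperiodic_word =
  fixes x :: "nat \<Rightarrow> 'a"
  assumes finite_range: "finite (range x)"
    and aperiodic: "i < j \<Longrightarrow> \<exists>u. x (i + u) \<noteq> x (j + u)"
begin

lemma finite_blocks: "finite (blocks x n)"
proof (rule finite_subset)
  show "blocks x n \<subseteq> {xs. set xs \<subseteq> range x \<and> length xs = n}"
    by (auto simp: blocks_def)
  show "finite {xs. set xs \<subseteq> range x \<and> length xs = n}"
    by (rule finite_lists_length_eq[OF finite_range])
qed

lemma repeats_exists: "\<exists>i j. repeats x n i j \<and> j \<le> card (blocks x n)"
proof -
  let ?f = "\<lambda>j. map (\<lambda>u. x (j + u)) [0..<n]"
  have "card (?f ` {..card (blocks x n)}) \<le> card (blocks x n)"
    by (intro card_mono finite_blocks) (auto simp: blocks_def)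
  hence "\<not> inj_on ?f {..card (blocks x n)}"
    by (intro pigeonhole) simp
  then obtain i j where ij: "i \<le> card (blocks x n)" "j \<le> card (blocks x n)" "i \<noteq> j" "?f i = ?f j"
    by (auto simp: inj_on_def)
  show ?thesis
  proof (cases "i < j")
    case True
    hence "repeats x n i j"
      using ij by (auto simp: repeats_def map_shift_eq_iff)
    thus ?thesis using ij by blast
  next
    case False
    hence "repeats x n j i"
      using ij by (auto simp: repeats_def map_shift_eq_iff)
    thus ?thesis using ij by blast
  qed
qed

text \<open>Morse and Hedlund: if there are no more blocks of length \<open>n + 1\<close> than of length \<open>n\<close>, then every
  block of length \<open>n\<close> determines the next letter, and a repeated block is followed by the same
  letters forever.\<close>
lemma card_blocks_less_Suc: "card (blocks x n) < card (blocks x (Suc n))"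
proof (rule ccontr)
  assume "\<not> ?thesis"
  hence le: "card (blocks x (Suc n)) \<le> card (blocks x n)" by simp
  have img: "take n ` blocks x (Suc n) = blocks x n"
    by (auto simp: blocks_def image_def take_map)
  have inj: "inj_on (take n) (blocks x (Suc n))"
    by (rule eq_card_imp_inj_on[OF finite_blocks])
      (use le img card_image_le[OF finite_blocks, of "take n" "Suc n"] in simp)
  have extend: "x (i + n) = x (j + n)" if "\<forall>u<n. x (i + u) = x (j + u)" for i j
  proof -
    have "map (\<lambda>u. x (i + u)) [0..<Suc n] = map (\<lambda>u. x (j + u)) [0..<Suc n]"
      by (rule inj_onD[OF inj])
        (use that in \<open>auto simp: blocks_def take_map map_shift_eq_iff simp del: upt_Suc\<close>)
    thus ?thesis by (simp add: map_shift_eq_iff del: upt_Suc)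
  qed
  obtain i j where ij: "repeats x n i j" using repeats_exists by blast
  have same: "\<forall>u<n. x (i + k + u) = x (j + k + u)" for k
  proof (induction k)
    case 0
    thus ?case using ij by (simp add: repeats_def)
  next
    case (Suc k)
    show ?case
    proof (intro allI impI)
      fix u assume "u < n"
      hence "Suc u < n \<or> Suc u = n" by auto
      hence "x (i + k + Suc u) = x (j + k + Suc u)"
        using Suc.IH extend[OF Suc.IH] by auto
      thus "x (i + Suc k + u) = x (j + Suc k + u)" by simp
    qed
  qed
  have "x (i + n + k) = x (j + n + k)" for k
    using extend[OF same[of k]] by (simp add: ac_simps)
  moreover have "i + n < j + n" using ij by (simp add: repeats_def)
  ultimately show False using aperiodic by blast
qed

lemma card_blocks_diff_le: "m \<le> n \<Longrightarrow> card (blocks x m) + (n - m) \<le> card (blocks x n)"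
proof (induction n rule: dec_induct)
  case (step n)
  thus ?case using card_blocks_less_Suc[of n] by linarith
qed simp

lemma card_blocks_gt: "n < card (blocks x n)"
proof -
  have "blocks x 0 = {[]}" by (auto simp: blocks_def)
  thus ?thesis using card_blocks_diff_le[of 0 n] by simp
qed

section \<open>First repetitions\<close>

lemma repeats_earlier_later: "repeats x n (earlier x n) (later x n)"
proof -
  have "\<exists>j i. repeats x n i j" using repeats_exists by blast
  hence "\<exists>i. repeats x n i (later x n)"
    unfolding later_def by (rule LeastI_ex)
  thus ?thesis unfolding earlier_def by (rule someI_ex)
qed

lemma later_le: "repeats x n i j \<Longrightarrow> later x n \<le> j"
  unfolding later_def by (rule Least_le) blast

lemma earlier_less_later: "earlier x n < later x n"
  using repeats_earlier_later by (simp add: repeats_def)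

lemma later_le_card_blocks: "later x n \<le> card (blocks x n)"
  using repeats_exists later_le order_trans by blast

lemma match_length_mismatch: "x (earlier x n + match_length x n) \<noteq> x (later x n + match_length x n)"
  unfolding match_length_def by (rule LeastI_ex) (use aperiodic earlier_less_later in blast)

lemma repeats_match_length: "repeats x (match_length x n) (earlier x n) (later x n)"
  using earlier_less_later not_less_Least unfolding repeats_def match_length_def by blast

lemma le_match_length: "n \<le> match_length x n"
  using match_length_mismatch repeats_earlier_later by (meson not_le repeats_def)

text \<open>Two earlier occurrences of the same block would already form a repetition that ends sooner.\<close>
lemma earlier_unique:
  assumes "repeats x n i (later x n)"
  shows "i = earlier x n"
proof (rule ccontr)
  assume ne: "i \<noteq> earlier x n"
  have "repeats x n (min i (earlier x n)) (max i (earlier x n))"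
    using ne assms repeats_earlier_later by (auto simp: repeats_def min_def max_def)
  hence "later x n \<le> max i (earlier x n)" by (rule later_le)
  thus False
    using assms earlier_less_later[of n] by (simp add: repeats_def max_def split: if_splits)
qed

lemma later_less_later_Suc_match_length: "later x n < later x (Suc (match_length x n))"
proof -
  let ?m = "Suc (match_length x n)"
  have "repeats x n (earlier x ?m) (later x ?m)"
    using repeats_mono[OF repeats_earlier_later] le_match_length by (meson le_Suc_eq)
  moreover have "\<not> repeats x ?m (earlier x n) (later x n)"
    using match_length_mismatch by (auto simp: repeats_def)
  ultimately show ?thesis
    using later_le earlier_unique repeats_earlier_later by (metis le_neq_implies_less)
qed

text \<open>The block between the two occurrences is repeated as long as they agree.\<close>
lemma periodic_on_match:
  "periodic_on x (later x n - earlier x n) (earlier x n) (later x n + match_length x n)"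
  unfolding periodic_on_def
proof (intro allI impI)
  fix u assume u: "earlier x n \<le> u" "u + (later x n - earlier x n) < later x n + match_length x n"
  then obtain v where v: "u = earlier x n + v" using le_Suc_ex by blast
  have "v < match_length x n" using u v earlier_less_later[of n] by simp
  thus "x u = x (u + (later x n - earlier x n))"
    using repeats_match_length[of n] v earlier_less_later[of n] by (simp add: repeats_def add.commute)
qed

text \<open>Let \<open>s\<close> and \<open>s'\<close> be the periods of the two runs. If the runs overlapped in \<open>s + s'\<close> letters,
  then at the end \<open>E\<close> of the first run one could go back by \<open>s'\<close>, then back by \<open>s\<close>, and forward again
  by \<open>s'\<close>, and find that \<open>x E = x (E - s)\<close>, so that the first run would not end at \<open>E\<close>.\<close>
lemma min_earlier_less:
  assumes "later x n + match_length x n < later x n' + match_length x n'"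
  shows "match_length x n + min (earlier x n) (earlier x n') < later x n'"
proof (rule ccontr)
  assume contr: "\<not> ?thesis"
  define i i' s s' E where "i = earlier x n" and "i' = earlier x n'"
    and "s = later x n - i" and "s' = later x n' - i'" and "E = later x n + match_length x n"
  note defs = i_def i'_def s_def s'_def E_def
  have j: "later x n = i + s" "later x n' = i' + s'" "0 < s" "0 < s'"
    using earlier_less_later[of n] earlier_less_later[of n'] by (auto simp: defs)
  have p: "periodic_on x s i E" "periodic_on x s' i' (later x n' + match_length x n')"
    using periodic_on_match by (auto simp: defs)
  have E: "i + s + s' \<le> E" "i' + s + s' \<le> E" "E < later x n' + match_length x n'"
    using contr assms j unfolding E_def i_def[symmetric] i'_def[symmetric] by (auto simp: min_def split: if_splits)
  have "x E = x (E - s')"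
    using periodic_onD[OF p(2), of "E - s'"] E by simp
  also have "\<dots> = x (E - s' - s)"
    using periodic_onD[OF p(1), of "E - s' - s"] E j by simp
  also have "\<dots> = x (E - s)"
    using periodic_onD[OF p(2), of "E - s' - s"] E j by simp
  finally show False
    using match_length_mismatch[of n] j E unfolding E_def i_def[symmetric] by (simp add: add.commute)
qed

end

section \<open>Words in which periodic runs are short\<close>

text \<open>Apart from aperiodicity, the only trace of the number \<open>\<xi>\<close> in the combinatorial argument is the
  bound \<open>end_le\<close> on periodic runs. It holds for the expansion of \<open>\<xi>\<close> whenever \<open>t + 1\<close> exceeds the irrationality
  exponent.\<close>
locale badly_approximable_word = aperiodic_word x
  for x :: "nat \<Rightarrow> 'a" +
  fixes t C :: real
  assumes t: "1 \<le> t" and C: "0 \<le> C"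
    and end_le: "1 \<le> s \<Longrightarrow> periodic_on x s m E \<Longrightarrow> real E \<le> (t + 1) * (m + s) + C"
begin

lemma match_length_le: "match_length x n \<le> t * later x n + C"
proof -
  have "real (later x n + match_length x n) \<le> (t + 1) * (earlier x n + (later x n - earlier x n)) + C"
    using end_le[OF _ periodic_on_match[of n]] earlier_less_later[of n] by simp
  thus ?thesis using earlier_less_later[of n] by (simp add: of_nat_diff algebra_simps)
qed

text \<open>Let the runs of \<open>n\<close> and \<open>n'\<close> start at \<open>i\<close> and \<open>i'\<close> with periods \<open>s < s'\<close>, and let the first one end at
  \<open>i + s + N\<close> (the case \<open>s > s'\<close> is similar). On their common part, going forward by \<open>s'\<close> and back by \<open>s\<close> shows
  that \<open>s' - s\<close> is a period as well. It persists up to position \<open>i + N\<close>, and it starts at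
  position \<open>max i' (i - (s' - s))\<close>, possibly before \<open>i\<close>, because the run with period \<open>s\<close> only enters
  after the shift. This early start is essential for the final constants.\<close>
lemma match_length_le_later_diff:
  assumes j: "later x n < later x n'"
    and E: "later x n + match_length x n < later x n' + match_length x n'"
  shows "match_length x n \<le> (t + 1) * (real (later x n') - later x n)
           + t * max (earlier x n) (earlier x n') + C"
proof -
  define i i' s s' where "i = earlier x n" and "i' = earlier x n'"
    and "s = later x n - i" and "s' = later x n' - i'"
  note defs = i_def i'_def s_def s'_def
  have later: "later x n = i + s" "later x n' = i' + s'" and pos: "0 < s" "0 < s'"
    using earlier_less_later[of n] earlier_less_later[of n'] by (auto simp: defs)
  define N N' where "N = match_length x n" and "N' = match_length x n'"
  have "periodic_on x s i (later x n + N)" "periodic_on x s' i' (later x n' + N')"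
    unfolding defs N_def N'_def by (rule periodic_on_match)+
  hence p: "periodic_on x s i (i + s + N)" "periodic_on x s' i' (i' + s' + N')"
    unfolding later .
  have mismatch: "x (i + N) \<noteq> x (i + s + N)"
    using match_length_mismatch[of n] later(1) by (simp add: N_def i_def)
  have lt: "i + s < i' + s'" "i + s + N < i' + s' + N'"
    using j E later by (auto simp: N_def N'_def)
  have "real N \<le> (t + 1) * (real (i' + s') - (i + s)) + t * max i i' + C"
  proof (cases s s' rule: linorder_cases)
    case equal
    \<comment> \<open>The second run would continue the first one beyond its end if it contained \<open>i + N\<close>.\<close>
    have "i + N < i'"
      using periodic_onD[OF p(2), of "i + N"] mismatch lt equal by (force simp: ac_simps)
    hence "real N \<le> t * max i i'"
      using mult_mono[of 1 t "real N" "real (max i i')"] t by simp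
    moreover have "0 \<le> (t + 1) * (real (i' + s') - (i + s))"
      using lt t by (intro mult_nonneg_nonneg) auto
    ultimately show ?thesis using C by linarith
  next
    case less
    have "periodic_on x (s' - s) (max i' (i - (s' - s))) (i + N)"
      unfolding periodic_on_def
    proof (intro allI impI)
      fix u assume u: "max i' (i - (s' - s)) \<le> u" "u + (s' - s) < i + N"
      have "x u = x (u + s')"
        using periodic_onD[OF p(2), of u] u less lt by simp
      also have "\<dots> = x (u + (s' - s) + s)"
        using less by simp
      also have "\<dots> = x (u + (s' - s))"
      proof (rule periodic_onD[OF p(1)])
        show "i \<le> u + (s' - s)" using u(1) by (simp only: max.bounded_iff le_diff_conv)
        show "u + (s' - s) + s < i + s + N" using u(2) by (simp only: add.commute add_less_cancel_left add.assoc add.left_commute)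
      qed
      finally show "x u = x (u + (s' - s))" .
    qed
    from end_le[OF _ this]
    have "real (i + N) \<le> (t + 1) * (max i' (i - (s' - s)) + (s' - s)) + C"
      using less by simp
    also have "max i' (i - (s' - s)) = i'"
      using lt less by (intro max_absorb1) (simp add: le_diff_conv)
    also have "i' + (s' - s) = i' + s' - s"
      using less by simp
    \<comment> \<open>The preperiod and the period add up to \<open>i' + s' - s = (i' + s') - (i + s) + i\<close>, so one of the
      \<open>t + 1\<close> copies of \<open>i\<close> cancels against the left-hand side.\<close>
    finally have "real (i + N) \<le> (t + 1) * (real i' + s' - s) + C"
      using less by (simp add: of_nat_diff)
    hence "real N \<le> (t + 1) * (real (i' + s') - (i + s)) + t * i + C"
      by (simp add: algebra_simps)
    also have "t * i \<le> t * max i i'"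
      using t by (intro mult_left_mono) auto
    finally show ?thesis by simp
  next
    case greater
    have "periodic_on x (s - s') (max i (i' - (s - s'))) (i + s + N - s')"
      unfolding periodic_on_def
    proof (intro allI impI)
      fix u assume u: "max i (i' - (s - s')) \<le> u" "u + (s - s') < i + s + N - s'"
      have "x u = x (u + s)"
        using periodic_onD[OF p(1), of u] u greater lt by simp
      also have "\<dots> = x (u + (s - s'))"
        using periodic_onD[OF p(2), of "u + (s - s')"] u greater lt by simp
      finally show "x u = x (u + (s - s'))" .
    qed
    from end_le[OF _ this]
    have "real (i + s + N - s') \<le> (t + 1) * (max i (i' - (s - s')) + (s - s')) + C"
      using greater by simp
    also have "max i (i' - (s - s')) = i' - (s - s')"
      using greater lt by (intro max_absorb2) (simp add: le_diff_conv2)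
    also have "i' - (s - s') + (s - s') = i'"
      using greater lt by simp
    finally have "real N \<le> (real (i' + s') - (i + s)) + t * i' + C"
      using greater by (simp add: of_nat_diff algebra_simps)
    also have "t * i' \<le> t * max i i'"
      using t by (intro mult_left_mono) auto
    also have "real (i' + s') - (i + s) \<le> (t + 1) * (real (i' + s') - (i + s))"
      using lt t mult_right_mono[of 1 "t + 1" "real (i' + s') - (i + s)"] by simp
    finally show ?thesis by simp
  qed
  thus ?thesis unfolding later N_def i_def[symmetric] i'_def[symmetric] .
qed

abbreviation "J k \<equiv> later x (stage x k)"
abbreviation "N k \<equiv> match_length x (stage x k)"

lemma J_less_Suc: "J k < J (Suc k)"
  using later_less_later_Suc_match_length[of "stage x k"] by simp

lemma J_mono: "k \<le> l \<Longrightarrow> J k \<le> J l"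
  by (rule lift_Suc_mono_le[of J]) (use J_less_Suc less_imp_le in auto)

lemma J_strict_mono: "k < l \<Longrightarrow> J k < J l"
  using J_less_Suc by (rule lift_Suc_mono_less)

lemma N_less_Suc: "N k < N (Suc k)"
  using le_match_length[of "stage x (Suc k)"] by simp

lemma N_strict_mono: "k < l \<Longrightarrow> N k < N l"
  using N_less_Suc by (rule lift_Suc_mono_less)

lemma N_ge: "k \<le> N k"
  using N_strict_mono by (intro strict_mono_imp_increasing) (simp add: strict_mono_def)

lemma J_Suc_le_card_blocks: "J (Suc k) \<le> card (blocks x (Suc (N k)))"
  using later_le_card_blocks[of "stage x (Suc k)"] by simp

text \<open>Among the four repetitions \<open>k, \<dots>, k + 3\<close> there are two, at distance at most two, that start within
  the first \<open>D\<close> places: if number \<open>k + 1\<close> does, it is paired with \<open>k + 2\<close> or \<open>k + 3\<close>, and otherwise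
  \<open>k\<close> and \<open>k + 2\<close> do. The rest is elimination. The hypothesis covers only three gaps, as the last
  repetition may have any length.\<close>
lemma J_le_gap_multiple:
  fixes D :: real
  assumes gap: "\<And>l. k \<le> l \<Longrightarrow> l \<le> k + 2 \<Longrightarrow> real (J (Suc l)) \<le> N l + D"
    and P: "0 \<le> 1 + 2 * t - t ^ 2 - t ^ 3"
  shows "(1 + 2 * t - t ^ 2 - t ^ 3) * J (k + 2)
           \<le> (t ^ 3 + 2 * t ^ 2 + 3 * t + 1) * D + (2 * t + 1) * (t + 1) * C"
proof -
  let ?i = "\<lambda>l. earlier x (stage x l)"
  have min: "min (?i l) (?i (Suc l)) \<le> D" if "k \<le> l" "l \<le> k + 2" for l
  proof -
    have "N l + min (?i l) (?i (Suc l)) < J (Suc l)"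
      by (rule min_earlier_less) (intro add_strict_mono J_less_Suc N_less_Suc)
    thus ?thesis using gap[OF that] by linarith
  qed
  have "\<exists>a b. k \<le> a \<and> a \<le> k + 1 \<and> a < b \<and> b \<le> a + 2 \<and> real (?i a) \<le> D \<and> real (?i b) \<le> D"
  proof (cases "real (?i (k + 1)) \<le> D")
    case True
    have "real (?i (k + 2)) \<le> D \<or> real (?i (k + 3)) \<le> D"
      using min[of "k + 2"] by (auto simp: min_def eval_nat_numeral split: if_splits)
    thus ?thesis
    proof
      assume "real (?i (k + 2)) \<le> D"
      thus ?thesis using True by (intro exI[of _ "k + 1"] exI[of _ "k + 2"]) auto
    next
      assume "real (?i (k + 3)) \<le> D"
      thus ?thesis using True by (intro exI[of _ "k + 1"] exI[of _ "k + 3"]) auto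
    qed
  next
    case False
    hence "real (?i k) \<le> D" "real (?i (k + 2)) \<le> D"
      using min[of k] min[of "k + 1"] by (auto simp: min_def eval_nat_numeral split: if_splits)
    thus ?thesis by (intro exI[of _ k] exI[of _ "k + 2"]) auto
  qed
  then obtain a b where a: "k \<le> a" "a \<le> k + 1" and b: "a < b" "b \<le> a + 2"
    and small: "real (?i a) \<le> D" "real (?i b) \<le> D" by blast
  have "N a \<le> (t + 1) * (real (J b) - J a) + t * max (?i a) (?i b) + C"
    by (rule match_length_le_later_diff) (intro add_strict_mono J_strict_mono N_strict_mono b)+
  also have "t * max (?i a) (?i b) \<le> t * D"
    using small t by (intro mult_left_mono) auto
  also have "(t + 1) * (real (J b) - J a) \<le> (t + 1) * (real (J (a + 2)) - J a)"
    using J_mono[OF b(2)] t by (intro mult_left_mono) auto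
  finally have main: "N a \<le> (t + 1) * (real (J (a + 2)) - J a) + t * D + C" by simp
  define n j j' n' j'' where "n = real (N a)" and "j = real (J a)" and "j' = real (J (Suc a))"
    and "n' = real (N (Suc a))" and "j'' = real (J (a + 2))"
  have ineqs: "n \<le> t * j + C" "j' \<le> n + D" "n' \<le> t * j' + C" "j'' \<le> n' + D"
    "n \<le> (t + 1) * (j'' - j) + t * D + C"
    using match_length_le[of "stage x a"] match_length_le[of "stage x (Suc a)"] gap[of a] gap[of "Suc a"] a main
    by (auto simp: n_def j_def j'_def n'_def j''_def)
  \<comment> \<open>Eliminate \<open>j\<close>, then \<open>j'\<close> and \<open>n'\<close>, and finally \<open>n\<close>.\<close>
  have "t * n \<le> t * ((t + 1) * (j'' - j) + t * D + C)"
    using ineqs t by (intro mult_left_mono) auto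
  moreover have "(t + 1) * n \<le> (t + 1) * (t * j + C)"
    using ineqs t by (intro mult_left_mono) auto
  ultimately have upper: "(2 * t + 1) * n \<le> t * (t + 1) * j'' + t ^ 2 * D + (2 * t + 1) * C"
    by (simp add: algebra_simps power2_eq_square)
  have "t * j' \<le> t * (n + D)"
    using ineqs t by (intro mult_left_mono) auto
  hence "j'' \<le> t * n + (t + 1) * D + C"
    using ineqs by (simp add: algebra_simps)
  hence "(2 * t + 1) * j'' \<le> (2 * t + 1) * (t * n + (t + 1) * D + C)"
    using t by (intro mult_left_mono) auto
  moreover have "t * ((2 * t + 1) * n) \<le> t * (t * (t + 1) * j'' + t ^ 2 * D + (2 * t + 1) * C)"
    using upper t by (intro mult_left_mono) auto
  ultimately have "(1 + 2 * t - t ^ 2 - t ^ 3) * j''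
      \<le> (t ^ 3 + 2 * t ^ 2 + 3 * t + 1) * D + (2 * t + 1) * (t + 1) * C"
    by (simp add: algebra_simps power2_eq_square power3_eq_cube)
  moreover have "(1 + 2 * t - t ^ 2 - t ^ 3) * J (k + 2) \<le> (1 + 2 * t - t ^ 2 - t ^ 3) * j''"
    unfolding j''_def using P a J_mono[of "k + 2" "a + 2"] by (intro mult_left_mono) auto
  ultimately show ?thesis by linarith
qed

text \<open>For a bad \<open>n\<close>, locate \<open>n\<close> between two consecutive match lengths, \<open>N (k + 2) < n \<le> N (k + 3)\<close>.
  Since \<open>card (blocks x n) - n\<close> is nondecreasing, the excess at \<open>n\<close> bounds all previous gaps, and
  \<open>n \<le> t * J (k + 3) + C\<close> then bounds \<open>n\<close> in terms of \<open>J (k + 2)\<close>. The polynomial hypothesis is a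
  convenient strengthening of \<open>\<delta> * t * Q < P\<close>; the two agree for \<open>t = 1\<close>.\<close>
lemma eventually_card_blocks_gt:
  fixes \<delta> :: real
  assumes \<delta>: "\<delta> * (t * (t + 1) ^ 3) < 1 + 2 * t - 2 * t ^ 3" and pos: "0 < 1 + 2 * t - 2 * t ^ 3"
  shows "\<forall>\<^sub>F n in sequentially. (1 + \<delta>) * n < card (blocks x n)"
proof -
  define P R Q where "P = 1 + 2 * t - t ^ 2 - t ^ 3" and "R = t ^ 3 + 2 * t ^ 2 + 3 * t + 1"
    and "Q = t * R + P"
  \<comment> \<open>Elimination will yield \<open>P * n \<le> t * Q * D + K\<close> with \<open>D = \<delta> * n + 1\<close>.\<close>
  define K where "K = t ^ 2 * ((2 * t + 1) * (t + 1) * C) + P * ((t + 1) * C)"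
  have "P = (1 + 2 * t - 2 * t ^ 3) + t ^ 2 * (t - 1)"
    unfolding P_def by (simp add: algebra_simps eval_nat_numeral)
  hence P: "0 < P" using pos t by (simp add: add_pos_nonneg)
  have R: "0 < R" unfolding R_def using t by (simp add: add_nonneg_pos)
  hence Q: "0 < Q" unfolding Q_def using P t by (simp add: add_pos_pos)
  have "(\<delta> * (t * (t + 1) ^ 3)) * Q < (1 + 2 * t - 2 * t ^ 3) * Q"
    using \<delta> Q by simp
  also have "\<dots> = P * (t + 1) ^ 3 - t ^ 4 * (2 * t + 1) * ((t - 1) * (t + 1))"
    unfolding P_def Q_def R_def by (simp add: algebra_simps eval_nat_numeral)
  also have "\<dots> \<le> P * (t + 1) ^ 3"
    using t by simp
  finally have "(\<delta> * t * Q) * (t + 1) ^ 3 < P * (t + 1) ^ 3"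
    by (simp add: algebra_simps)
  hence \<epsilon>: "0 < P - \<delta> * t * Q"
    using t by (simp add: mult_less_cancel_right)
  have gt: "(1 + \<delta>) * n < card (blocks x n)"
    if n: "N 2 < n" "(t * Q + K) / (P - \<delta> * t * Q) < n" for n :: nat
  proof (rule ccontr)
    assume "\<not> ?thesis"
    hence card: "real (card (blocks x n)) \<le> n + \<delta> * n" by (simp add: algebra_simps)
    define l where "l = (LEAST l. n \<le> N l)"
    have l: "n \<le> N l" unfolding l_def by (rule LeastI[of _ n]) (rule N_ge)
    have l': "N i < n" if "i < l" for i
      using not_less_Least[OF that[unfolded l_def]] by simp
    have "2 < l"
    proof (rule ccontr)
      assume "\<not> 2 < l"
      hence "N l \<le> N 2" using N_strict_mono[of l 2] by (cases "l = 2") auto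
      thus False using l n by simp
    qed
    then obtain k where k: "l = k + 3" using le_Suc_ex[of 3 l] by (auto simp: add.commute)
    define D where "D = \<delta> * n + 1"
    have gap: "real (J (Suc i)) \<le> N i + D" if "k \<le> i" "i \<le> k + 2" for i
    proof -
      have "card (blocks x (Suc (N i))) + (n - Suc (N i)) \<le> card (blocks x n)"
        using l'[of i] that k by (intro card_blocks_diff_le) simp
      hence "J (Suc i) + n \<le> card (blocks x n) + Suc (N i)"
        using J_Suc_le_card_blocks[of i] l'[of i] that k by linarith
      thus ?thesis using card unfolding D_def by linarith
    qed
    have core: "P * J (k + 2) \<le> R * D + (2 * t + 1) * (t + 1) * C"
      unfolding P_def R_def by (rule J_le_gap_multiple[OF gap]) (use P in \<open>auto simp: P_def\<close>)
    have "real n \<le> t * J (k + 3) + C"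
      using l[unfolded k] match_length_le[of "stage x (k + 3)"] by (meson of_nat_le_iff order_trans)
    also have "real (J (k + 3)) \<le> (t * J (k + 2) + C) + D"
      using gap[of "k + 2"] match_length_le[of "stage x (k + 2)"] by (simp add: eval_nat_numeral)
    finally have "real n \<le> t * (t * J (k + 2) + C + D) + C"
      using t by simp
    hence "P * n \<le> P * (t * (t * J (k + 2) + C + D) + C)"
      using P by (intro mult_left_mono) auto
    also have "\<dots> = t ^ 2 * (P * J (k + 2)) + P * t * D + P * ((t + 1) * C)"
      by (simp add: algebra_simps power2_eq_square)
    also have "t ^ 2 * (P * J (k + 2)) \<le> t ^ 2 * (R * D + (2 * t + 1) * (t + 1) * C)"
      using core by (intro mult_left_mono) auto
    finally have "P * n \<le> t * Q * D + K"
      unfolding K_def Q_def by (simp add: algebra_simps power2_eq_square)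
    hence "(P - \<delta> * t * Q) * n \<le> t * Q + K"
      unfolding D_def by (simp add: algebra_simps)
    hence "n \<le> (t * Q + K) / (P - \<delta> * t * Q)"
      using \<epsilon> by (simp add: pos_le_divide_eq mult.commute)
    thus False using n by simp
  qed
  have "\<forall>\<^sub>F n in sequentially. (t * Q + K) / (P - \<delta> * t * Q) < real n"
    by (rule filterlim_at_top_dense[THEN iffD1, OF filterlim_real_sequentially, rule_format])
  with eventually_gt_at_top[of "N 2"] show ?thesis
    by eventually_elim (rule gt)
qed

text \<open>Here \<open>n\<close> can be chosen as the match length \<open>N (k + 2)\<close>, so that \<open>n \<le> t * J (k + 2) + C\<close>.
  This saves the passage from \<open>N (k + 2)\<close> to \<open>N (k + 3)\<close>.\<close>
lemma not_eventually_card_blocks_le: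
  fixes \<delta> :: real
  assumes \<delta>: "\<delta> * (t * (3 * t ^ 2 + 3 * t + 1)) < 1 + 2 * t - 2 * t ^ 3"
    and pos: "0 < 1 + 2 * t - 2 * t ^ 3" and \<delta>0: "0 \<le> \<delta>"
  shows "\<not> (\<forall>\<^sub>F n in sequentially. card (blocks x n) \<le> (1 + \<delta>) * n)"
proof
  assume "\<forall>\<^sub>F n in sequentially. card (blocks x n) \<le> (1 + \<delta>) * n"
  then obtain n0 where card: "\<And>n. n0 \<le> n \<Longrightarrow> card (blocks x n) \<le> (1 + \<delta>) * n"
    by (auto simp: eventually_sequentially)
  define P R S where "P = 1 + 2 * t - t ^ 2 - t ^ 3" and "R = t ^ 3 + 2 * t ^ 2 + 3 * t + 1"
    and "S = 3 * t ^ 2 + 3 * t + 1"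
  \<comment> \<open>Elimination will yield \<open>P * n \<le> t * R * \<delta> * n + K\<close>.\<close>
  define K where "K = t * R * (1 + \<delta>) + t * ((2 * t + 1) * (t + 1) * C) + P * C"
  have "P = (1 + 2 * t - 2 * t ^ 3) + t ^ 2 * (t - 1)"
    unfolding P_def by (simp add: algebra_simps eval_nat_numeral)
  hence P: "0 < P" using pos t by (simp add: add_pos_nonneg)
  have R: "0 < R" unfolding R_def using t by (simp add: add_nonneg_pos)
  have S: "0 < S" unfolding S_def using t by (simp add: add_nonneg_pos)
  have "(\<delta> * (t * S)) * R < (1 + 2 * t - 2 * t ^ 3) * R"
    using \<delta> R unfolding S_def by simp
  also have "\<dots> = P * S - t ^ 3 * (2 * t + 1) * ((t - 1) * (t + 1))"
    unfolding P_def R_def S_def by (simp add: algebra_simps eval_nat_numeral)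
  also have "\<dots> \<le> P * S"
    using t by simp
  finally have "(\<delta> * t * R) * S < P * S"
    by (simp add: algebra_simps)
  hence \<epsilon>: "0 < P - \<delta> * t * R"
    using S by simp
  obtain k where k: "n0 \<le> k" "K / (P - \<delta> * t * R) < k"
  proof -
    obtain k where "K / (P - \<delta> * t * R) < real k" using reals_Archimedean2 by blast
    thus ?thesis by (intro that[of "max n0 k"]) (auto simp: of_nat_max)
  qed
  define n where "n = N (k + 2)"
  define D where "D = \<delta> * n + (1 + \<delta>)"
  have gap: "real (J (Suc i)) \<le> N i + D" if "k \<le> i" "i \<le> k + 2" for i
  proof -
    have "N i \<le> n"
      using N_strict_mono[of i "k + 2"] that unfolding n_def by (cases "i = k + 2") auto
    hence "\<delta> * N i \<le> \<delta> * n" using \<delta>0 by (intro mult_left_mono) auto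
    moreover have "card (blocks x (Suc (N i))) \<le> (1 + \<delta>) * real (Suc (N i))"
      using N_ge[of i] that k by (intro card) simp
    moreover have "real (J (Suc i)) \<le> card (blocks x (Suc (N i)))"
      using J_Suc_le_card_blocks[of i] by simp
    ultimately show ?thesis unfolding D_def by (simp add: algebra_simps)
  qed
  have core: "P * J (k + 2) \<le> R * D + (2 * t + 1) * (t + 1) * C"
    unfolding P_def R_def by (rule J_le_gap_multiple[OF gap]) (use P in \<open>auto simp: P_def\<close>)
  have "P * n \<le> P * (t * J (k + 2) + C)"
    using P match_length_le[of "stage x (k + 2)"] unfolding n_def by (intro mult_left_mono) auto
  also have "\<dots> = t * (P * J (k + 2)) + P * C"
    by (simp add: algebra_simps)
  also have "t * (P * J (k + 2)) \<le> t * (R * D + (2 * t + 1) * (t + 1) * C)"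
    using core t by (intro mult_left_mono) auto
  finally have "(P - \<delta> * t * R) * n \<le> K"
    unfolding D_def K_def by (simp add: algebra_simps)
  hence "n \<le> K / (P - \<delta> * t * R)"
    using \<epsilon> by (simp add: pos_le_divide_eq mult.commute)
  thus False using k N_ge[of "k + 2"] unfolding n_def by linarith
qed

end

section \<open>Periodic runs and rational approximation\<close>

text \<open>Dirichlet's theorem counts coprime pairs; these are determined by their quotient.\<close>
lemma infinite_square_approximations:
  fixes \<xi> :: real
  assumes "\<xi> \<notin> \<rat>"
  shows "infinite {r. \<exists>p q :: int. q \<ge> 1 \<and> r = of_int p / of_int q \<and>
                      \<bar>\<xi> - r\<bar> < 1 / of_int q powr 2}" (is "infinite ?S")
proof
  assume "finite ?S"
  let ?f = "\<lambda>(h, k). real_of_int h / real_of_int k"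
  have "?f ` approx_set \<xi> \<subseteq> ?S"
  proof (intro image_subsetI, unfold split_paired_all prod.case mem_Collect_eq)
    fix h k :: int assume "(h, k) \<in> approx_set \<xi>"
    hence "k \<ge> 1 \<and> \<bar>\<xi> - of_int h / of_int k\<bar> < 1 / of_int k powr 2"
      by (auto simp: approx_set_def powr_numeral)
    thus "\<exists>p q :: int. q \<ge> 1 \<and> real_of_int h / real_of_int k = of_int p / of_int q \<and>
        \<bar>\<xi> - of_int h / of_int k\<bar> < 1 / of_int q powr 2" by blast
  qed
  with \<open>finite ?S\<close> have "finite (?f ` approx_set \<xi>)"
    by (rule rev_finite_subset)
  moreover have "inj_on ?f (approx_set \<xi>)"
  proof (rule inj_onI, clarify)
    fix h k h' k' :: int
    assume *: "(h, k) \<in> approx_set \<xi>" "(h', k') \<in> approx_set \<xi>"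
      and eq: "real_of_int h / real_of_int k = real_of_int h' / real_of_int k'"
    hence k: "k > 0" "k' > 0" "coprime h k" "coprime h' k'"
      by (auto simp: approx_set_def)
    have "real_of_int (h * k') = real_of_int (h' * k)"
      using eq k by (simp add: field_simps)
    hence "h * k' = h' * k" by (simp only: of_int_eq_iff)
    hence "\<bar>h\<bar> * \<bar>k'\<bar> = \<bar>h'\<bar> * \<bar>k\<bar>" by (metis abs_mult)
    hence "k = k'"
      using k coprime_crossproduct_int[where a = h and d = k and b = h' and c = k'] by simp
    thus "h = h' \<and> k = k'"
      using \<open>h * k' = h' * k\<close> k by simp
  qed
  ultimately have "finite (approx_set \<xi>)" by (rule finite_imageD)
  thus False using assms rational_iff_finite_approx_set by blast
qed

lemma irrationality_exponent_ge_2: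
  fixes \<xi> :: real
  assumes "\<xi> \<notin> \<rat>"
  shows "2 \<le> irrationality_exponent \<xi>"
proof -
  have "ereal 2 \<le> irrationality_exponent \<xi>"
    unfolding irrationality_exponent_def
    using infinite_square_approximations[OF assms] by (intro Sup_upper) auto
  thus ?thesis by simp
qed

text \<open>Only finitely many rationals violate the bound with \<open>c = 1\<close>, and \<open>\<xi>\<close> is none of them, so it
  suffices to lower \<open>c\<close>.\<close>
lemma irrationality_exponent_lower_bound:
  assumes "\<xi> \<notin> \<rat>" and "irrationality_exponent \<xi> < ereal \<mu>"
  obtains c where "0 < c" "\<And>p q :: int. q \<ge> 1 \<Longrightarrow> c / of_int q powr \<mu> \<le> \<bar>\<xi> - of_int p / of_int q\<bar>"
proof -
  define S where "S = {r. \<exists>p q :: int. q \<ge> 1 \<and> r = of_int p / of_int q \<and>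
                      \<bar>\<xi> - r\<bar> < 1 / of_int q powr \<mu>}"
  have "finite S"
  proof (rule ccontr)
    assume "infinite S"
    hence "ereal \<mu> \<le> irrationality_exponent \<xi>"
      unfolding irrationality_exponent_def S_def by (intro Sup_upper) auto
    thus False using assms(2) by simp
  qed
  define c where "c = Min (insert 1 ((\<lambda>r. \<bar>\<xi> - r\<bar>) ` S))"
  have c: "c \<le> 1" "\<And>r. r \<in> S \<Longrightarrow> c \<le> \<bar>\<xi> - r\<bar>"
    using \<open>finite S\<close> by (auto simp: c_def)
  have "\<xi> \<notin> S"
    using assms(1) by (auto simp: S_def)
  hence "0 < c"
    using \<open>finite S\<close> by (auto simp: c_def)
  moreover have "c / of_int q powr \<mu> \<le> \<bar>\<xi> - of_int p / of_int q\<bar>" if q: "q \<ge> 1" for p q :: int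
  proof (cases "(of_int p / of_int q :: real) \<in> S")
    case True
    have "0 \<le> irrationality_exponent \<xi>"
      using irrationality_exponent_ge_2[OF assms(1)] by (rule order_trans[rotated]) simp
    hence "0 \<le> \<mu>" using assms(2) by (metis ereal_less_eq(5) less_le order_less_le_trans)
    hence "1 \<le> real_of_int q powr \<mu>"
      using q by (intro ge_one_powr_ge_zero) auto
    hence "c / of_int q powr \<mu> \<le> c"
      using \<open>0 < c\<close> by (simp add: divide_le_eq)
    thus ?thesis using c(2)[OF True] by linarith
  next
    case False
    have "c / of_int q powr \<mu> \<le> 1 / of_int q powr \<mu>"
      using c(1) by (intro divide_right_mono) auto
    also have "\<dots> \<le> \<bar>\<xi> - of_int p / of_int q\<bar>"
      using False q unfolding S_def by force
    finally show ?thesis .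
  qed
  ultimately show ?thesis by (rule that)
qed

text \<open>The number in \<open>[0, 1]\<close> with digits \<open>a k, a (k + 1), \<dots>\<close>, written with a finite sum so that its
  recursion and its integrality modulo \<open>b ^ k * \<xi>\<close> are immediate.\<close>
definition tail :: "nat \<Rightarrow> real \<Rightarrow> (nat \<Rightarrow> nat) \<Rightarrow> nat \<Rightarrow> real" where
  "tail b \<xi> a k = real b ^ k * (\<xi> - of_int \<lfloor>\<xi>\<rfloor> - (\<Sum>j<k. real (a j) / real b ^ (j + 1)))"

lemma tail_Suc:
  assumes "b \<ge> 2"
  shows "tail b \<xi> a (Suc k) = real b * tail b \<xi> a k - real (a k)"
  using assms by (simp add: tail_def field_simps)

lemma tail_bounds:
  assumes "b \<ge> 2" and exp: "is_expansion b \<xi> a"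
  shows "0 \<le> tail b \<xi> a k" "tail b \<xi> a k \<le> 1"
proof -
  have "(\<lambda>j. real (a (j + k)) / real b ^ (j + k + 1)) sums
      (\<xi> - of_int \<lfloor>\<xi>\<rfloor> - (\<Sum>j<k. real (a j) / real b ^ (j + 1)))"
    using exp unfolding is_expansion_def by (subst sums_iff_shift) (simp add: add.commute)
  from sums_mult[OF this, of "real b ^ k"]
  have s: "(\<lambda>j. real (a (j + k)) / real b ^ (j + 1)) sums tail b \<xi> a k"
    using assms(1) by (simp add: tail_def power_add)
  have d: "a j < b" for j using exp by (simp add: is_expansion_def)
  show "0 \<le> tail b \<xi> a k"
    by (rule sums_le[OF _ sums_zero s]) auto
  have le: "real (a j) \<le> real b - 1" for j
    using d[of j] by linarith
  show "tail b \<xi> a k \<le> 1"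
    by (rule sums_le[OF _ s sums_digits_max[OF assms(1)]]) (intro divide_right_mono le, simp)
qed

lemma tail_eq_power_minus_int:
  assumes "b \<ge> 2"
  shows "\<exists>z :: int. tail b \<xi> a k = real b ^ k * \<xi> - z"
proof (induction k)
  case 0
  thus ?case by (simp add: tail_def)
next
  case (Suc k)
  then obtain z :: int where z: "tail b \<xi> a k = real b ^ k * \<xi> - z" by blast
  hence "tail b \<xi> a (Suc k) = real b ^ Suc k * \<xi> - of_int (int b * z + int (a k))"
    unfolding tail_Suc[OF assms] z by (simp add: algebra_simps)
  thus ?case by blast
qed

text \<open>As long as the digits agree, the difference of two tails is multiplied by \<open>b\<close> in each step, and it
  never exceeds \<open>1\<close>.\<close>
lemma tail_diff_le:
  assumes b: "b \<ge> 2" and exp: "is_expansion b \<xi> a" and eq: "\<And>u. u < n \<Longrightarrow> a (k + u) = a (l + u)"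
  shows "\<bar>tail b \<xi> a k - tail b \<xi> a l\<bar> \<le> 1 / real b ^ n"
proof -
  let ?T = "tail b \<xi> a"
  have "?T (k + u) - ?T (l + u) = real b ^ u * (?T k - ?T l)" if "u \<le> n" for u
    using that
  proof (induction u)
    case (Suc u)
    have "?T (k + Suc u) - ?T (l + Suc u) = real b * (?T (k + u) - ?T (l + u))"
      using eq[of u] Suc.prems by (simp add: tail_Suc[OF b] right_diff_distrib)
    thus ?case using Suc by simp
  qed simp
  from this[of n] have "real b ^ n * \<bar>?T k - ?T l\<bar> = \<bar>?T (k + n) - ?T (l + n)\<bar>"
    by (simp add: abs_mult)
  also have "\<dots> \<le> 1"
    using tail_bounds[OF b exp, of "k + n"] tail_bounds[OF b exp, of "l + n"] by linarith
  finally show ?thesis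
    using b by (simp add: field_simps)
qed

text \<open>Up to integers, the tails at \<open>m\<close> and \<open>m + s\<close> are \<open>b ^ m * \<xi>\<close> and \<open>b ^ (m + s) * \<xi>\<close>. Their
  difference is small because they share the digits up to \<open>E\<close>, and it is the distance of
  \<open>b ^ m * (b ^ s - 1) * \<xi>\<close> from an integer.\<close>
lemma periodic_approximation:
  assumes b: "b \<ge> 2" and exp: "is_expansion b \<xi> a" and s: "1 \<le> s"
    and per: "periodic_on a s m E"
  obtains p :: int where
    "\<bar>\<xi> - of_int p / of_int (int b ^ m * (int b ^ s - 1))\<bar> \<le> real b / real b ^ E"
proof -
  let ?T = "tail b \<xi> a" and ?q = "real b ^ m * (real b ^ s - 1)"
  obtain z z' :: int where z: "?T m = real b ^ m * \<xi> - z" "?T (m + s) = real b ^ (m + s) * \<xi> - z'"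
    using tail_eq_power_minus_int[OF b] by meson
  have "b ^ 1 \<le> b ^ s" using b s by (intro power_increasing) auto
  hence bs: "real b \<le> real b ^ s"
    by (metis of_nat_le_iff of_nat_power power_one_right)
  have "real b ^ (s - 1) * 2 \<le> real b ^ (s - 1) * real b"
    using b by (intro mult_left_mono) auto
  also have "\<dots> = real b ^ s"
    using s by (cases s) auto
  finally have "real b ^ (s - 1) \<le> real b ^ s - 1"
    using b one_le_power[of "real b" "s - 1"] by linarith
  hence q: "real b ^ m * real b ^ (s - 1) \<le> ?q"
    by (intro mult_left_mono) auto
  have "0 < real b ^ s - 1" using b bs by linarith
  hence q_pos: "0 < ?q" using b by (intro mult_pos_pos) auto
  let ?n = "E - (m + s)"
  \<comment> \<open>For \<open>E < m + s\<close> the truncated difference is \<open>0\<close>, and the bound is still good enough.\<close>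
  have "\<bar>?T (m + s) - ?T m\<bar> \<le> 1 / real b ^ ?n"
    by (rule tail_diff_le[OF b exp])
      (use periodic_onD[OF per, of "m + u" for u] in \<open>simp add: ac_simps\<close>)
  also have "?T (m + s) - ?T m = ?q * \<xi> - of_int (z' - z)"
    unfolding z by (simp add: algebra_simps power_add)
  finally have "\<bar>?q * \<xi> - of_int (z' - z)\<bar> / ?q \<le> 1 / real b ^ ?n / ?q"
    using q_pos by (intro divide_right_mono) auto
  also have "\<bar>?q * \<xi> - of_int (z' - z)\<bar> / ?q = \<bar>(?q * \<xi> - of_int (z' - z)) / ?q\<bar>"
    using q_pos by (simp only: abs_divide abs_of_pos)
  also have "(?q * \<xi> - of_int (z' - z)) / ?q = \<xi> - of_int (z' - z) / ?q"
    using q_pos by (simp only: diff_divide_distrib nonzero_mult_div_cancel_left less_imp_neq[symmetric] not_False_eq_True)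
  also have "1 / real b ^ ?n / ?q \<le> 1 / real b ^ ?n / (real b ^ m * real b ^ (s - 1))"
    using q q_pos b by (intro divide_left_mono) auto
  also have "\<dots> = 1 / real b ^ (?n + m + (s - 1))"
    by (simp add: power_add)
  also have "\<dots> \<le> real b / real b ^ E"
  proof -
    have "E \<le> Suc (?n + m + (s - 1))" using s by linarith
    hence "real b ^ E \<le> real b ^ Suc (?n + m + (s - 1))"
      using b by (intro power_increasing) auto
    thus ?thesis using b by (simp add: field_simps)
  qed
  finally show ?thesis
    by (intro that[of "z' - z"]) simp
qed

lemma period_end_le:
  assumes b: "b \<ge> 2" and exp: "is_expansion b \<xi> a"
    and \<xi>: "\<xi> \<notin> \<rat>" and \<mu>: "irrationality_exponent \<xi> < ereal \<mu>" "0 \<le> \<mu>"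
  obtains C where "0 \<le> C"
    "\<And>s m E. 1 \<le> s \<Longrightarrow> periodic_on a s m E \<Longrightarrow> real E \<le> \<mu> * (m + s) + C"
proof -
  obtain c where c: "0 < c"
    "\<And>p q :: int. q \<ge> 1 \<Longrightarrow> c / of_int q powr \<mu> \<le> \<bar>\<xi> - of_int p / of_int q\<bar>"
    using irrationality_exponent_lower_bound[OF \<xi> \<mu>(1)] by blast
  have "real E \<le> \<mu> * (m + s) + max 0 (1 - log b c)" if s: "1 \<le> s" and per: "periodic_on a s m E" for s m E
  proof -
    define q where "q = int b ^ m * (int b ^ s - 1)"
    obtain p :: int where p: "\<bar>\<xi> - of_int p / of_int q\<bar> \<le> real b / real b ^ E"
      unfolding q_def by (rule periodic_approximation[OF b exp s per])
    have "int b ^ 1 \<le> int b ^ s" using b s by (intro power_increasing) auto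
    hence "1 \<le> int b ^ s - 1" using b unfolding power_one_right by linarith
    moreover have "1 \<le> int b ^ m" using b by (intro one_le_power) auto
    ultimately have q1: "1 \<le> q"
      unfolding q_def using mult_mono[of 1 "int b ^ m" 1 "int b ^ s - 1"] by simp
    have "q \<le> int b ^ m * int b ^ s"
      unfolding q_def by (intro mult_left_mono) auto
    hence "real_of_int q \<le> real_of_int (int b ^ (m + s))"
      unfolding of_int_le_iff by (simp add: power_add)
    also have "\<dots> = real b powr (m + s)"
      using b by (simp add: powr_realpow[symmetric])
    finally have "real_of_int q powr \<mu> \<le> (real b powr (m + s)) powr \<mu>"
      using \<mu>(2) q1 by (intro powr_mono2) auto
    hence "c / (real b powr (m + s)) powr \<mu> \<le> c / of_int q powr \<mu>"
      using c(1) q1 b by (intro divide_left_mono mult_pos_pos) auto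
    also have "\<dots> \<le> real b / real b ^ E"
      using c(2)[OF q1, of p] p by linarith
    also have "\<dots> = real b powr (1 - real E)"
      using b by (simp add: powr_diff powr_realpow)
    finally have "c \<le> real b powr (1 - real E) * real b powr (\<mu> * (m + s))"
      using b by (simp add: powr_powr field_simps)
    also have "\<dots> = real b powr (1 - real E + \<mu> * (m + s))"
      by (simp add: powr_add)
    finally have "log b c \<le> 1 - real E + \<mu> * (m + s)"
      using b c(1) by (simp add: log_le_iff)
    thus ?thesis by simp
  qed
  thus ?thesis using that[of "max 0 (1 - log b c)"] by simp
qed

lemma aperiodic_word_expansion:
  assumes b: "b \<ge> 2" and exp: "is_expansion b \<xi> a" and \<xi>: "\<xi> \<notin> \<rat>"
  shows "aperiodic_word a"
proof
  show "finite (range a)"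
    by (rule finite_subset[of _ "{..<b}"]) (use exp in \<open>auto simp: is_expansion_def\<close>)
next
  fix i j :: nat assume ij: "i < j"
  show "\<exists>u. a (i + u) \<noteq> a (j + u)"
  proof (rule ccontr)
    assume "\<not> ?thesis"
    hence "\<bar>tail b \<xi> a i - tail b \<xi> a j\<bar> \<le> 1 / real b ^ n" for n
      by (intro tail_diff_le[OF b exp]) auto
    moreover have "(\<lambda>n. 1 / real b ^ n) \<longlonglongrightarrow> 0"
      using b LIMSEQ_power_zero[of "1 / real b"] by (simp add: power_one_over)
    ultimately have "\<bar>tail b \<xi> a i - tail b \<xi> a j\<bar> \<le> 0"
      by (intro LIMSEQ_le_const) auto
    moreover obtain z z' :: int where "tail b \<xi> a i = real b ^ i * \<xi> - z" "tail b \<xi> a j = real b ^ j * \<xi> - z'"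
      using tail_eq_power_minus_int[OF b] by meson
    ultimately have "(real b ^ j - real b ^ i) * \<xi> = of_int (z' - z)"
      by (simp add: algebra_simps)
    moreover have "real b ^ i < real b ^ j"
      using ij b by (intro power_strict_increasing) auto
    ultimately have "\<xi> = of_int (z' - z) / (of_nat (b ^ j) - of_nat (b ^ i))"
      by (simp add: field_simps)
    also have "\<dots> \<in> \<rat>"
      by (intro Rats_divide Rats_diff Rats_of_int Rats_of_nat)
    finally show False using \<xi> by simp
  qed
qed

section \<open>Complexity of expansions\<close>

lemma badly_approximable_word_expansion:
  assumes b: "b \<ge> 2" and \<xi>: "\<xi> \<notin> \<rat>" and \<mu>: "irrationality_exponent \<xi> < ereal (t + 1)" "1 \<le> t"
  obtains C where "badly_approximable_word (expansion b \<xi>) t C"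
proof -
  note exp = is_expansion_expansion[OF b, of \<xi>]
  interpret aperiodic_word "expansion b \<xi>"
    by (rule aperiodic_word_expansion[OF b exp \<xi>])
  obtain C where "0 \<le> C" "\<And>s m E. 1 \<le> s \<Longrightarrow> periodic_on (expansion b \<xi>) s m E \<Longrightarrow>
      real E \<le> (t + 1) * (m + s) + C"
    using period_end_le[OF b exp \<xi> \<mu>(1)] \<mu>(2) by auto
  thus ?thesis using \<mu>(2) by (intro that[of C]) (unfold_locales, auto)
qed

lemma complexity_eq_card_blocks: "complexity n \<xi> b = card (blocks (expansion b \<xi>) n)"
  by (simp add: complexity_def blocks_def)

lemma complexity_ge:
  assumes "b \<ge> 2" "\<xi> \<notin> \<rat>"
  shows "n < complexity n \<xi> b"
  unfolding complexity_eq_card_blocks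
  by (intro aperiodic_word.card_blocks_gt aperiodic_word_expansion[OF _ is_expansion_expansion] assms)

text \<open>The approximation bound is only available above the irrationality exponent. As the inequalities
  to be refuted are strict and continuous in the exponent, there is room for a slightly larger one.\<close>
lemma exists_larger_exponent:
  fixes g :: "real \<Rightarrow> real"
  assumes "isCont g m" "0 < g m"
  obtains m' where "m < m'" "0 < g m'"
proof -
  have "(g \<longlongrightarrow> g m) (at_right m)"
    using assms(1) by (auto simp: isCont_def intro: filterlim_at_split[THEN iffD1, THEN conjunct2])
  hence "\<forall>\<^sub>F y in at_right m. 0 < g y" using assms(2) by (rule order_tendstoD)
  then obtain y where "m < y" "\<forall>z>m. z < y \<longrightarrow> 0 < g z"
    by (auto simp: eventually_at_right_field)
  thus ?thesis using that[of "(m + y) / 2"] by simp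
qed

lemma liminf_complexity_ge_1:
  assumes "b \<ge> 2" "\<xi> \<notin> \<rat>"
  shows "ereal 1 \<le> liminf (\<lambda>n. ereal (real (complexity n \<xi> b) / real n))"
proof (rule Liminf_bounded)
  show "\<forall>\<^sub>F n in sequentially. ereal 1 \<le> ereal (real (complexity n \<xi> b) / real n)"
    using eventually_gt_at_top[of 0]
    by eventually_elim (use complexity_ge[OF assms] in \<open>simp add: less_imp_le\<close>)
qed

text \<open>A real \<open>r\<close> between the lower limit and the claimed bound satisfies \<open>r > 1\<close>, so the claimed bound
  exceeds \<open>1\<close>, and the polynomial inequality for \<open>\<delta> = r - 1\<close> holds at \<open>m\<close>, hence at some larger
  \<open>t + 1\<close>.\<close>
lemma liminf_complexity_ge:
  fixes m :: real
  assumes b: "b \<ge> 2" and \<xi>: "\<xi> \<notin> \<rat>" and m: "irrationality_exponent \<xi> = ereal m" "2 \<le> m"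
  shows "ereal (1 + (1 - 2 * m * (m - 1) * (m - 2)) / (m ^ 3 * (m - 1)))
           \<le> liminf (\<lambda>n. ereal (real (complexity n \<xi> b) / real n))"
proof (rule ccontr)
  assume "\<not> ?thesis"
  then obtain r where r: "liminf (\<lambda>n. ereal (real (complexity n \<xi> b) / real n)) < ereal r"
      "ereal r < ereal (1 + (1 - 2 * m * (m - 1) * (m - 2)) / (m ^ 3 * (m - 1)))"
    unfolding not_le using ereal_dense2 by blast
  define \<delta> where "\<delta> = r - 1"
  have "ereal 1 < ereal r"
    using liminf_complexity_ge_1[OF b \<xi>] r(1) by (rule order_le_less_trans)
  hence \<delta>: "0 < \<delta>" by (simp add: \<delta>_def)
  let ?g = "\<lambda>m. 1 - 2 * m * (m - 1) * (m - 2) - \<delta> * (m ^ 3 * (m - 1))"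
  have "0 < m ^ 3 * (m - 1)" using m(2) by simp
  moreover have "\<delta> < (1 - 2 * m * (m - 1) * (m - 2)) / (m ^ 3 * (m - 1))"
    using r(2) unfolding less_ereal.simps \<delta>_def by linarith
  ultimately have "0 < ?g m"
    by (simp only: pos_less_divide_eq diff_gt_0_iff_gt)
  moreover have "isCont ?g m" by (intro continuous_intros)
  ultimately obtain m' where m': "m < m'" "0 < ?g m'"
    using exists_larger_exponent[of m ?g] by blast
  define t where "t = m' - 1"
  have t: "1 \<le> t" "irrationality_exponent \<xi> < ereal (t + 1)" "m' = t + 1"
    using m m' by (auto simp: t_def)
  have g: "\<delta> * (t * (t + 1) ^ 3) < 1 + 2 * t - 2 * t ^ 3"
    using m'(2) unfolding t(3) by (simp add: algebra_simps eval_nat_numeral)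
  have "0 < \<delta> * (t * (t + 1) ^ 3)" using \<delta> t(1) by simp
  hence pos: "0 < 1 + 2 * t - 2 * t ^ 3" using g by linarith
  obtain C where "badly_approximable_word (expansion b \<xi>) t C"
    using badly_approximable_word_expansion[OF b \<xi> t(2,1)] .
  from badly_approximable_word.eventually_card_blocks_gt[OF this g pos]
  have "\<forall>\<^sub>F n in sequentially. ereal r \<le> ereal (real (complexity n \<xi> b) / real n)"
    using eventually_gt_at_top[of 0]
    by eventually_elim (simp add: complexity_eq_card_blocks \<delta>_def pos_le_divide_eq)
  hence "ereal r \<le> liminf (\<lambda>n. ereal (real (complexity n \<xi> b) / real n))"
    by (rule Liminf_bounded)
  thus False using r(1) by simp
qed

lemma limsup_complexity_ge:
  fixes m :: real
  assumes b: "b \<ge> 2" and \<xi>: "\<xi> \<notin> \<rat>" and m: "irrationality_exponent \<xi> = ereal m" "2 \<le> m"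
  shows "ereal (1 + (1 - 2 * m * (m - 1) * (m - 2)) / (3 * m ^ 3 - 6 * m ^ 2 + 4 * m - 1))
           \<le> limsup (\<lambda>n. ereal (real (complexity n \<xi> b) / real n))"
proof (rule ccontr)
  assume "\<not> ?thesis"
  then obtain r where r: "limsup (\<lambda>n. ereal (real (complexity n \<xi> b) / real n)) < ereal r"
      "ereal r < ereal (1 + (1 - 2 * m * (m - 1) * (m - 2)) / (3 * m ^ 3 - 6 * m ^ 2 + 4 * m - 1))"
    unfolding not_le using ereal_dense2 by blast
  define \<delta> where "\<delta> = r - 1"
  have "ereal 1 \<le> limsup (\<lambda>n. ereal (real (complexity n \<xi> b) / real n))"
    using liminf_complexity_ge_1[OF b \<xi>] Liminf_le_Limsup[OF sequentially_bot] by (rule order_trans)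
  hence "ereal 1 < ereal r" using r(1) by (rule order_le_less_trans)
  hence \<delta>: "0 < \<delta>" by (simp add: \<delta>_def)
  let ?d = "\<lambda>m. 3 * m ^ 3 - 6 * m ^ 2 + 4 * m - 1"
  let ?g = "\<lambda>m. 1 - 2 * m * (m - 1) * (m - 2) - \<delta> * ?d m"
  have d: "?d m = (m - 1) * (3 * (m - 1) ^ 2 + 3 * (m - 1) + 1)" for m :: real
    by (simp add: algebra_simps eval_nat_numeral)
  have d_pos: "0 < ?d m"
    unfolding d using m(2) by (intro mult_pos_pos add_nonneg_pos add_nonneg_nonneg) auto
  moreover have "\<delta> < (1 - 2 * m * (m - 1) * (m - 2)) / ?d m"
    using r(2) unfolding less_ereal.simps \<delta>_def by linarith
  ultimately have "0 < ?g m"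
    by (simp only: pos_less_divide_eq diff_gt_0_iff_gt)
  moreover have "isCont ?g m" by (intro continuous_intros)
  ultimately obtain m' where m': "m < m'" "0 < ?g m'"
    using exists_larger_exponent[of m ?g] by blast
  define t where "t = m' - 1"
  have t: "1 \<le> t" "irrationality_exponent \<xi> < ereal (t + 1)" "m' = t + 1"
    using m m' by (auto simp: t_def)
  have g: "\<delta> * (t * (3 * t ^ 2 + 3 * t + 1)) < 1 + 2 * t - 2 * t ^ 3"
    using m'(2) unfolding t(3) by (simp add: algebra_simps eval_nat_numeral)
  have "0 < t * (3 * t ^ 2 + 3 * t + 1)"
    using t(1) by (intro mult_pos_pos add_nonneg_pos add_nonneg_nonneg) auto
  hence "0 < \<delta> * (t * (3 * t ^ 2 + 3 * t + 1))" using \<delta> by simp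
  hence pos: "0 < 1 + 2 * t - 2 * t ^ 3" using g by linarith
  obtain C where word: "badly_approximable_word (expansion b \<xi>) t C"
    using badly_approximable_word_expansion[OF b \<xi> t(2,1)] .
  have "\<forall>\<^sub>F n in sequentially. ereal (real (complexity n \<xi> b) / real n) < ereal r"
    using r(1) by (rule Limsup_lessD)
  hence "\<forall>\<^sub>F n in sequentially. card (blocks (expansion b \<xi>) n) \<le> (1 + \<delta>) * n"
    using eventually_gt_at_top[of 0]
    by eventually_elim (simp add: complexity_eq_card_blocks \<delta>_def pos_divide_less_eq)
  thus False
    using badly_approximable_word.not_eventually_card_blocks_le[OF word g pos] \<delta> by simp
qed

theorem theorem1p4:
  fixes b :: nat and \<xi> :: real and \<mu> :: ereal
  assumes "b \<ge> 2" and "\<xi> \<notin> \<rat>" and "\<mu> = irrationality_exponent \<xi>"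
  shows
    "(\<forall>m :: real. \<mu> = ereal m \<longrightarrow>
        liminf (\<lambda>n. ereal (real (complexity n \<xi> b) / real n))
          \<ge> ereal (1 + (1 - 2 * m * (m - 1) * (m - 2)) / (m ^ 3 * (m - 1))) \<and>
        limsup (\<lambda>n. ereal (real (complexity n \<xi> b) / real n))
          \<ge> ereal (1 + (1 - 2 * m * (m - 1) * (m - 2)) / (3 * m ^ 3 - 6 * m ^ 2 + 4 * m - 1))) \<and>
     (\<mu> = \<infinity> \<longrightarrow>
        liminf (\<lambda>n. ereal (real (complexity n \<xi> b) / real n)) \<ge> ereal 1 \<and>
        limsup (\<lambda>n. ereal (real (complexity n \<xi> b) / real n)) \<ge> ereal (1 / 3)) \<and>
     (\<mu> = ereal 2 \<longrightarrow>
        liminf (\<lambda>n. ereal (real (complexity n \<xi> b) / real n)) \<ge> ereal (9 / 8) \<and>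
        limsup (\<lambda>n. ereal (real (complexity n \<xi> b) / real n)) \<ge> ereal (8 / 7))"
    (is "(\<forall>m. \<mu> = ereal m \<longrightarrow> ?inf m \<and> ?sup m) \<and> ?infinite \<and> ?two")
proof -
  have finite: "?inf m \<and> ?sup m" if "\<mu> = ereal m" for m
  proof -
    have "irrationality_exponent \<xi> = ereal m" "2 \<le> m"
      using that assms(3) irrationality_exponent_ge_2[OF assms(2)] by simp_all
    thus ?thesis
      using liminf_complexity_ge[OF assms(1,2)] limsup_complexity_ge[OF assms(1,2)] by blast
  qed
  moreover have ?infinite
  proof (intro impI conjI)
    show inf: "ereal 1 \<le> liminf (\<lambda>n. ereal (real (complexity n \<xi> b) / real n))"
      by (rule liminf_complexity_ge_1[OF assms(1,2)])
    have "ereal (1 / 3) \<le> ereal 1" by simp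
    also note inf
    also note Liminf_le_Limsup[OF sequentially_bot]
    finally show "ereal (1 / 3) \<le> limsup (\<lambda>n. ereal (real (complexity n \<xi> b) / real n))" .
  qed
  moreover have ?two
    using finite[of 2] by simp
  ultimately show ?thesis by blast
qed

end
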